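(* Let $(X,\mu,\nu,\ast,\diamond)$ be a non-empty compact non-Archimedean intuitionistic fuzzy metric space, let $\psi\in\Psi$ and $\phi\in\Phi$, and let $f:X\to X$ be an intuitionistic fuzzy $\psi$-$\phi$-contractive mapping. Then $f$ has a unique fixed point.
   Context: A continuous t-norm is a continuous, commutative, associative operation $\ast:[0,1]\times[0,1]\to[0,1]$ with $a\ast 1=a$ for all $a$, and $a\ast b\le c\ast d$ whenever $a\le c$, $b\le d$. A continuous t-conorm is a continuous, commutative, associative operation $\diamond:[0,1]\times[0,1]\to[0,1]$ with $a\diamond 0=a$ for all $a$, and $a\diamond b\le c\diamond d$ whenever $a\le c$, $b\le d$. A non-Archimedean intuitionistic fuzzy metric space is a 5-tuple $(X,\mu,\nu,\ast,\diamond)$ where $X$ is a set, $\ast$ is a continuous t-norm, $\diamond$ is a continuous t-conorm, and $\mu,\nu: X^2\times(0,\infty)\to[0,1]$ satisfy, for all $x,y,z\in X$ and $s,t>0$: (i) $\mu(x,y,t)+\nu(x,y,t)\le 1$; (ii) $\mu(x,y,t)>0$; (iii) $\mu(x,y,t)=1$ if and only if $x=y$; (iv) $\mu(x,y,t)=\mu(y,x,t)$; (v) $\mu(x,z,\max\{t,s\})\ge\mu(x,y,t)\ast\mu(y,z,s)$; (vi) $\mu(x,y,\cdot):(0,\infty)\to(0,1]$ is continuous; (vii) $\nu(x,y,t)=0$ if and only if $x=y$; (viii) $\nu(x,y,t)=\nu(y,x,t)$; (ix) $\nu(x,z,\max\{t,s\})\le\nu(x,y,t)\diamond\nu(y,z,s)$;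 (x) $\nu(x,y,\cdot):(0,\infty)\to[0,1]$ is continuous. A sequence $\{x_n\}$ in $X$ converges to $x\in X$ if $\lim_{n\to\infty}\mu(x_n,x,t)=1$ and $\lim_{n\to\infty}\nu(x_n,x,t)=0$ for all $t>0$. The space is compact if every sequence in $X$ has a subsequence converging to a point of $X$. $\Psi$ is the class of all continuous, non-decreasing maps $\psi:[0,1]\to[0,1]$ with $\psi(t)<t$ for all $t\in(0,1)$. $\Phi$ is the class of all continuous, non-decreasing maps $\phi:[0,1]\to[0,1]$ with $\phi(t)>t$ for all $t\in(0,1)$. For $\psi\in\Psi$, $\phi\in\Phi$, a map $f:X\to X$ is intuitionistic fuzzy $\psi$-$\phi$-contractive if for all $x,y\in X$ and $t>0$: $\mu(x,y,t)>0$ implies $\psi(\mu(f(x),f(y),t))\ge\mu(x,y,t)$, and $\nu(x,y,t)<1$ implies $\phi(\nu(f(x),f(y),t))\le\nu(x,y,t)$. *)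

theory Defs
  imports "HOL-Analysis.Analysis"
begin

text \<open>
  Operations on the unit interval, the carrier of a space, and maps on it are represented by total
  HOL functions that are constrained only on the relevant sets: values outside
  \<^term>\<open>{0..1::real}\<close>, outside the carrier, or at parameters \<open>t \<le> 0\<close> are irrelevant.
\<close>

locale continuous_t_norm =
  fixes T :: "real \<Rightarrow> real \<Rightarrow> real"
  assumes t_norm_closed: "\<lbrakk>a \<in> {0..1}; b \<in> {0..1}\<rbrakk> \<Longrightarrow> T a b \<in> {0..1}"
    and t_norm_continuous: "continuous_on ({0..1} \<times> {0..1}) (\<lambda>(a, b). T a b)"
    and t_norm_commute: "\<lbrakk>a \<in> {0..1}; b \<in> {0..1}\<rbrakk> \<Longrightarrow> T a b = T b a"
    and t_norm_assoc:
      "\<lbrakk>a \<in> {0..1}; b \<in> {0..1}; c \<in> {0..1}\<rbrakk> \<Longrightarrow> T (T a b) c = T a (T b c)"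
    and t_norm_unit: "a \<in> {0..1} \<Longrightarrow> T a 1 = a"
    and t_norm_mono:
      "\<lbrakk>a \<in> {0..1}; b \<in> {0..1}; c \<in> {0..1}; d \<in> {0..1}; a \<le> c; b \<le> d\<rbrakk> \<Longrightarrow> T a b \<le> T c d"

locale continuous_t_conorm =
  fixes S :: "real \<Rightarrow> real \<Rightarrow> real"
  assumes t_conorm_closed: "\<lbrakk>a \<in> {0..1}; b \<in> {0..1}\<rbrakk> \<Longrightarrow> S a b \<in> {0..1}"
    and t_conorm_continuous: "continuous_on ({0..1} \<times> {0..1}) (\<lambda>(a, b). S a b)"
    and t_conorm_commute: "\<lbrakk>a \<in> {0..1}; b \<in> {0..1}\<rbrakk> \<Longrightarrow> S a b = S b a"
    and t_conorm_assoc: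
      "\<lbrakk>a \<in> {0..1}; b \<in> {0..1}; c \<in> {0..1}\<rbrakk> \<Longrightarrow> S (S a b) c = S a (S b c)"
    and t_conorm_unit: "a \<in> {0..1} \<Longrightarrow> S a 0 = a"
    and t_conorm_mono:
      "\<lbrakk>a \<in> {0..1}; b \<in> {0..1}; c \<in> {0..1}; d \<in> {0..1}; a \<le> c; b \<le> d\<rbrakk> \<Longrightarrow> S a b \<le> S c d"

locale na_intuitionistic_fuzzy_metric_space =
  continuous_t_norm T + continuous_t_conorm S
  for X :: "'a set"
    and \<mu> \<nu> :: "'a \<Rightarrow> 'a \<Rightarrow> real \<Rightarrow> real"
    and T S :: "real \<Rightarrow> real \<Rightarrow> real" +
  assumes mu_range: "\<lbrakk>x \<in> X; y \<in> X; 0 < t\<rbrakk> \<Longrightarrow> \<mu> x y t \<in> {0..1}"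
    and nu_range: "\<lbrakk>x \<in> X; y \<in> X; 0 < t\<rbrakk> \<Longrightarrow> \<nu> x y t \<in> {0..1}"
    and mu_nu_le_1: "\<lbrakk>x \<in> X; y \<in> X; 0 < t\<rbrakk> \<Longrightarrow> \<mu> x y t + \<nu> x y t \<le> 1"
    and mu_pos: "\<lbrakk>x \<in> X; y \<in> X; 0 < t\<rbrakk> \<Longrightarrow> \<mu> x y t > 0"
    and mu_eq_1_iff: "\<lbrakk>x \<in> X; y \<in> X; 0 < t\<rbrakk> \<Longrightarrow> \<mu> x y t = 1 \<longleftrightarrow> x = y"
    and mu_sym: "\<lbrakk>x \<in> X; y \<in> X; 0 < t\<rbrakk> \<Longrightarrow> \<mu> x y t = \<mu> y x t"
    and mu_triangle:
      "\<lbrakk>x \<in> X; y \<in> X; z \<in> X; 0 < t; 0 < s\<rbrakk> \<Longrightarrow> \<mu> x z (max t s) \<ge> T (\<mu> x y t) (\<mu> y z s)"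
    and mu_continuous: "\<lbrakk>x \<in> X; y \<in> X\<rbrakk> \<Longrightarrow> continuous_on {0<..} (\<mu> x y)"
    and nu_eq_0_iff: "\<lbrakk>x \<in> X; y \<in> X; 0 < t\<rbrakk> \<Longrightarrow> \<nu> x y t = 0 \<longleftrightarrow> x = y"
    and nu_sym: "\<lbrakk>x \<in> X; y \<in> X; 0 < t\<rbrakk> \<Longrightarrow> \<nu> x y t = \<nu> y x t"
    and nu_triangle:
      "\<lbrakk>x \<in> X; y \<in> X; z \<in> X; 0 < t; 0 < s\<rbrakk> \<Longrightarrow> \<nu> x z (max t s) \<le> S (\<nu> x y t) (\<nu> y z s)"
    and nu_continuous: "\<lbrakk>x \<in> X; y \<in> X\<rbrakk> \<Longrightarrow> continuous_on {0<..} (\<nu> x y)"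

definition if_converges ::
  "('a \<Rightarrow> 'a \<Rightarrow> real \<Rightarrow> real) \<Rightarrow> ('a \<Rightarrow> 'a \<Rightarrow> real \<Rightarrow> real) \<Rightarrow> (nat \<Rightarrow> 'a) \<Rightarrow> 'a \<Rightarrow> bool"
  where "if_converges \<mu> \<nu> \<sigma> x \<longleftrightarrow>
    (\<forall>t>0. (\<lambda>n. \<mu> (\<sigma> n) x t) \<longlonglongrightarrow> 1 \<and> (\<lambda>n. \<nu> (\<sigma> n) x t) \<longlonglongrightarrow> 0)"

definition if_compact ::
  "'a set \<Rightarrow> ('a \<Rightarrow> 'a \<Rightarrow> real \<Rightarrow> real) \<Rightarrow> ('a \<Rightarrow> 'a \<Rightarrow> real \<Rightarrow> real) \<Rightarrow> bool"
  where "if_compact X \<mu> \<nu> \<longleftrightarrow>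
    (\<forall>\<sigma>::nat \<Rightarrow> 'a. range \<sigma> \<subseteq> X \<longrightarrow>
      (\<exists>x\<in>X. \<exists>r::nat \<Rightarrow> nat. strict_mono r \<and> if_converges \<mu> \<nu> (\<sigma> \<circ> r) x))"

definition Psi_class :: "(real \<Rightarrow> real) set"
  where "Psi_class = {\<psi>. \<psi> ` {0..1} \<subseteq> {0..1} \<and> continuous_on {0..1} \<psi> \<and> mono_on {0..1} \<psi> \<and>
    (\<forall>t\<in>{0<..<1}. \<psi> t < t)}"

definition Phi_class :: "(real \<Rightarrow> real) set"
  where "Phi_class = {\<phi>. \<phi> ` {0..1} \<subseteq> {0..1} \<and> continuous_on {0..1} \<phi> \<and> mono_on {0..1} \<phi> \<and>
    (\<forall>t\<in>{0<..<1}. \<phi> t > t)}"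

definition if_contractive ::
  "'a set \<Rightarrow> ('a \<Rightarrow> 'a \<Rightarrow> real \<Rightarrow> real) \<Rightarrow> ('a \<Rightarrow> 'a \<Rightarrow> real \<Rightarrow> real) \<Rightarrow>
    (real \<Rightarrow> real) \<Rightarrow> (real \<Rightarrow> real) \<Rightarrow> ('a \<Rightarrow> 'a) \<Rightarrow> bool"
  where "if_contractive X \<mu> \<nu> \<psi> \<phi> f \<longleftrightarrow>
    (\<forall>x\<in>X. \<forall>y\<in>X. \<forall>t>0.
      (\<mu> x y t > 0 \<longrightarrow> \<psi> (\<mu> (f x) (f y) t) \<ge> \<mu> x y t) \<and>
      (\<nu> x y t < 1 \<longrightarrow> \<phi> (\<nu> (f x) (f y) t) \<le> \<nu> x y t))"

end

theory Submission
  imports Defs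
begin

text \<open>
  Fix the parameter \<open>t = 1\<close>. Along an orbit \<open>x\<^sub>n = f\<^sup>n x\<^sub>0\<close> the numbers \<open>\<mu> x\<^sub>n x\<^sub>n\<^sub>+\<^sub>1 1\<close> increase to a
  limit \<open>a > 0\<close> with \<open>a \<le> \<psi> a\<close>, so \<open>a = 1\<close>. If \<open>x\<close> is the limit of a subsequence of the orbit, then
  \<open>\<mu> x (f x) 1\<close> is bounded below by the \<open>T\<close>-product of \<open>\<mu> x x\<^sub>n 1\<close>, \<open>\<mu> x\<^sub>n x\<^sub>n\<^sub>+\<^sub>1 1\<close> and
  \<open>\<mu> x\<^sub>n\<^sub>+\<^sub>1 (f x) 1 \<ge> \<mu> x\<^sub>n x 1\<close>, which tends to \<open>1\<close> along that subsequence. Hence \<open>f x = x\<close>.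
\<close>

lemma Psi_class_le:
  assumes "\<psi> \<in> Psi_class" and "0 < a" "a \<le> 1"
  shows "\<psi> a \<le> a"
\<comment> \<open>The strict bound of the class covers only the open interval; at the endpoint
  \<open>1\<close> the bound comes from the range of \<open>\<psi>\<close>.\<close>
proof (cases "a = 1")
  case True
  have "\<psi> 1 \<in> {0..1}"
    using assms(1) by (simp add: Psi_class_def image_subset_iff)
  then show ?thesis
    using True by simp
next
  case False
  then show ?thesis
    using assms by (force simp: Psi_class_def)
qed

lemma Psi_class_post_fixed_eq_1:
  assumes "\<psi> \<in> Psi_class" and "0 < a" "a \<le> 1" "a \<le> \<psi> a"
  shows "a = 1"
  using assms by (force simp: Psi_class_def)

text \<open>Since \<open>\<psi>\<close> lies below the identity, the chain condition forces
  \<open>a\<close> to increase; by continuity the condition passes to the limit, and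
  \<open>1\<close> is the only positive candidate.\<close>

lemma Psi_class_chain_tendsto_1:
  fixes a :: "nat \<Rightarrow> real"
  assumes psi: "\<psi> \<in> Psi_class"
    and range: "\<And>n. 0 < a n" "\<And>n. a n \<le> 1"
    and chain: "\<And>n. a n \<le> \<psi> (a (Suc n))"
  shows "a \<longlonglongrightarrow> 1"
proof -
  have inc: "incseq a"
    using chain Psi_class_le[OF psi range] by (intro incseq_SucI) (rule order_trans)
  then obtain l where lim: "a \<longlonglongrightarrow> l" and le: "\<And>n. a n \<le> l"
    using incseq_convergent[OF inc, of 1] range(2) by blast
  \<comment> \<open>Positivity comes from \<open>a 0 \<le> l\<close>. It matters because
    \<open>0 \<le> \<psi> 0\<close> always holds, so the limit \<open>0\<close> has to be excluded
    separately.\<close>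
  have l: "0 < l" "l \<le> 1"
    using range(1)[of 0] le[of 0] LIMSEQ_le_const2[OF lim] range(2) by auto
  have "continuous_on {0..1} \<psi>"
    using psi by (simp add: Psi_class_def)
  then have "(\<lambda>n. \<psi> (a (Suc n))) \<longlonglongrightarrow> \<psi> l"
    by (rule continuous_on_tendsto_compose[OF _ LIMSEQ_Suc[OF lim]])
      (use l range in \<open>auto intro!: always_eventually less_imp_le\<close>)
  then have "l \<le> \<psi> l"
    using LIMSEQ_le[OF lim] chain by blast
  then show ?thesis
    using Psi_class_post_fixed_eq_1[OF psi l] lim by simp
qed

text \<open>Joint continuity of \<open>T\<close> at the corner \<open>(1, 1)\<close>, where the unit
  law gives \<open>T 1 1 = 1\<close>.\<close>

lemma (in continuous_t_norm) t_norm_tendsto_1: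
  assumes "f \<longlonglongrightarrow> 1" "g \<longlonglongrightarrow> 1" and "\<And>n. f n \<in> {0..1}" "\<And>n. g n \<in> {0..1}"
  shows "(\<lambda>n. T (f n) (g n)) \<longlonglongrightarrow> 1"
proof -
  have "(\<lambda>n. (\<lambda>(a, b). T a b) (f n, g n)) \<longlonglongrightarrow> (\<lambda>(a, b). T a b) (1, 1)"
    by (rule continuous_on_tendsto_compose[OF t_norm_continuous tendsto_Pair])
      (use assms in auto)
  then show ?thesis
    using t_norm_unit[of 1] by simp
qed

context na_intuitionistic_fuzzy_metric_space
begin

text \<open>Because \<open>max t t = t\<close>, the non-Archimedean triangle inequality can be
  iterated without changing the parameter, which lets the existence proof stay at one fixed
  \<open>t\<close>.\<close>

lemma mu_triangle3:
  assumes "x \<in> X" "y \<in> X" "z \<in> X" "w \<in> X" "0 < t"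
  shows "T (T (\<mu> x y t) (\<mu> y z t)) (\<mu> z w t) \<le> \<mu> x w t"
proof -
  have "T (T (\<mu> x y t) (\<mu> y z t)) (\<mu> z w t) \<le> T (\<mu> x z t) (\<mu> z w t)"
    using assms mu_triangle[of x y z t t] mu_range t_norm_closed
    by (intro t_norm_mono) auto
  also have "\<dots> \<le> \<mu> x w t"
    using assms mu_triangle[of x z w t t] by simp
  finally show ?thesis .
qed

text \<open>Contractivity at two fixed points reads
  \<open>\<mu> x y 1 \<le> \<psi> (\<mu> x y 1)\<close>, which forces the value
  \<open>1\<close>.\<close>

lemma contractive_fixed_point_unique:
  assumes psi: "\<psi> \<in> Psi_class" and contr: "if_contractive X \<mu> \<nu> \<psi> \<phi> f"
    and "x \<in> X" "f x = x" "y \<in> X" "f y = y"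
  shows "x = y"
proof -
  have "\<mu> x y 1 > 0"
    using assms by (simp add: mu_pos)
  moreover from this have "\<mu> x y 1 \<le> \<psi> (\<mu> x y 1)"
    using contr assms(3-6) by (force simp: if_contractive_def)
  ultimately have "\<mu> x y 1 = 1"
    using Psi_class_post_fixed_eq_1[OF psi] mu_range[of x y 1] assms by auto
  then show ?thesis
    using mu_eq_1_iff[of x y 1] assms by simp
qed

lemma contractive_fixed_point_exists:
  assumes "X \<noteq> {}" and compact: "if_compact X \<mu> \<nu>" and psi: "\<psi> \<in> Psi_class"
    and f: "f \<in> X \<rightarrow> X" and contr: "if_contractive X \<mu> \<nu> \<psi> \<phi> f"
  shows "\<exists>x\<in>X. f x = x"
proof -
  from \<open>X \<noteq> {}\<close> obtain x0 where "x0 \<in> X"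
    by blast
  define \<sigma> where "\<sigma> n = (f ^^ n) x0" for n
  have \<sigma>_Suc: "\<sigma> (Suc n) = f (\<sigma> n)" for n
    by (simp add: \<sigma>_def)
  have \<sigma>_in: "\<sigma> n \<in> X" for n
    by (induction n) (use \<open>x0 \<in> X\<close> f in \<open>auto simp: \<sigma>_def\<close>)
  obtain x r where "x \<in> X" and r: "strict_mono r" and conv: "if_converges \<mu> \<nu> (\<sigma> \<circ> r) x"
    using compact \<sigma>_in unfolding if_compact_def by (metis image_subsetI)
  have fx: "f x \<in> X"
    using f \<open>x \<in> X\<close> by blast
  have contr_mu: "\<mu> y z 1 \<le> \<psi> (\<mu> (f y) (f z) 1)" if "y \<in> X" "z \<in> X" for y z
    using contr mu_pos that by (simp add: if_contractive_def)

  have step: "(\<lambda>n. \<mu> (\<sigma> n) (\<sigma> (Suc n)) 1) \<longlonglongrightarrow> 1"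
  proof (rule Psi_class_chain_tendsto_1[OF psi])
    show "\<mu> (\<sigma> n) (\<sigma> (Suc n)) 1 > 0" for n
      using \<sigma>_in by (intro mu_pos) auto
    show "\<mu> (\<sigma> n) (\<sigma> (Suc n)) 1 \<le> 1" for n
      using mu_range[of "\<sigma> n" "\<sigma> (Suc n)" 1] \<sigma>_in by simp
    show "\<mu> (\<sigma> n) (\<sigma> (Suc n)) 1 \<le> \<psi> (\<mu> (\<sigma> (Suc n)) (\<sigma> (Suc (Suc n))) 1)" for n
      using contr_mu[OF \<sigma>_in \<sigma>_in, of n "Suc n"] by (simp only: \<sigma>_Suc)
  qed
  \<comment> \<open>The neighbour is \<open>Suc (r n)\<close>, not \<open>r (Suc n)\<close>:
    \<open>f\<close> advances along the full orbit, so this is a subsequence of the consecutive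
    values.\<close>
  have step_r: "(\<lambda>n. \<mu> (\<sigma> (r n)) (\<sigma> (Suc (r n))) 1) \<longlonglongrightarrow> 1"
    using LIMSEQ_subseq_LIMSEQ[OF step r] by (simp add: o_def)
  have to_x: "(\<lambda>n. \<mu> (\<sigma> (r n)) x 1) \<longlonglongrightarrow> 1"
    using conv by (simp add: if_converges_def)
  then have from_x: "(\<lambda>n. \<mu> x (\<sigma> (r n)) 1) \<longlonglongrightarrow> 1"
    using mu_sym[OF \<open>x \<in> X\<close> \<sigma>_in] by simp
  have to_fx: "(\<lambda>n. \<mu> (\<sigma> (Suc (r n))) (f x) 1) \<longlonglongrightarrow> 1"
  proof (rule tendsto_sandwich[OF _ _ to_x tendsto_const])
    \<comment> \<open>Contractivity combined with \<open>\<psi> a \<le> a\<close> shows that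
      \<open>f\<close> does not decrease \<open>\<mu>\<close>.\<close>
    have "\<mu> (\<sigma> k) x 1 \<le> \<mu> (\<sigma> (Suc k)) (f x) 1" for k
    proof -
      have "\<mu> (\<sigma> (Suc k)) (f x) 1 \<in> {0<..1}"
        using mu_range[OF \<sigma>_in fx, of 1] mu_pos[OF \<sigma>_in fx, of 1] by simp
      then show ?thesis
        using contr_mu[OF \<sigma>_in \<open>x \<in> X\<close>, of k] Psi_class_le[OF psi, of "\<mu> (\<sigma> (Suc k)) (f x) 1"]
        by (simp add: \<sigma>_Suc)
    qed
    then show "\<forall>\<^sub>F n in sequentially. \<mu> (\<sigma> (r n)) x 1 \<le> \<mu> (\<sigma> (Suc (r n))) (f x) 1"
      by simp
    show "\<forall>\<^sub>F n in sequentially. \<mu> (\<sigma> (Suc (r n))) (f x) 1 \<le> 1"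
      using mu_range[OF \<sigma>_in fx, of 1] by simp
  qed
  have "(\<lambda>n. T (T (\<mu> x (\<sigma> (r n)) 1) (\<mu> (\<sigma> (r n)) (\<sigma> (Suc (r n))) 1))
      (\<mu> (\<sigma> (Suc (r n))) (f x) 1)) \<longlonglongrightarrow> 1"
    by (intro t_norm_tendsto_1 from_x step_r to_fx t_norm_closed mu_range \<sigma>_in fx \<open>x \<in> X\<close>) simp_all
  then have "1 \<le> \<mu> x (f x) 1"
    by (rule LIMSEQ_le_const2) (use mu_triangle3 \<sigma>_in fx \<open>x \<in> X\<close> in auto)
  then have "\<mu> x (f x) 1 = 1"
    using mu_range[OF \<open>x \<in> X\<close> fx, of 1] by simp
  then show ?thesis
    using mu_eq_1_iff[OF \<open>x \<in> X\<close> fx, of 1] \<open>x \<in> X\<close> by (intro bexI[of _ x]) simp_all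
qed

end

theorem theorem4p3:
  fixes X :: "'a set"
    and \<mu> \<nu> :: "'a \<Rightarrow> 'a \<Rightarrow> real \<Rightarrow> real"
    and T S :: "real \<Rightarrow> real \<Rightarrow> real"
    and \<psi> \<phi> :: "real \<Rightarrow> real"
    and f :: "'a \<Rightarrow> 'a"
  assumes "na_intuitionistic_fuzzy_metric_space X \<mu> \<nu> T S"
    and "X \<noteq> {}"
    and "if_compact X \<mu> \<nu>"
    and "\<psi> \<in> Psi_class"
    and "\<phi> \<in> Phi_class"
    and "f \<in> X \<rightarrow> X"
    and "if_contractive X \<mu> \<nu> \<psi> \<phi> f"
  shows "\<exists>!x. x \<in> X \<and> f x = x"
proof -
  interpret na_intuitionistic_fuzzy_metric_space X \<mu> \<nu> T S
    by fact
  show ?thesis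
    using contractive_fixed_point_exists[OF assms(2,3,4,6,7)]
      contractive_fixed_point_unique[OF assms(4,7)] by blast
qed

end
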